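(* Let $X$ be a real topological vector space, let $n\ge 2$, let $\alpha_1,\ldots,\alpha_n$ be non-zero reals, and let $\mathbb{F}:=\mathbb{Q}(\alpha_1,\ldots,\alpha_n)\subseteq\mathbb{R}$. Let $Y$ be a vector space over $\mathbb{F}$, and let $K\subseteq X$ be a non-empty open connected set such that $\sum_{i\le n}\alpha_iK\subseteq K$. Then a function $f:K\to Y$ satisfies $$f\Big(\sum_{i\le n}\alpha_ix_i\Big)=\sum_{i\le n}\alpha_i f(x_i)\qquad\text{for all }x_1,\ldots,x_n\in K$$ if and only if there exist an $\mathbb{F}$-linear map $A:X\to Y$ and $b\in Y$ such that $f(x)=A(x)+b$ for all $x\in K$, with $b=0$ if $\sum_{i\le n}\alpha_i\neq 1$.
   Context: Here $\sum_{i\le n}\alpha_iK:=\{\sum_{i\le n}\alpha_ix_i: x_1,\ldots,x_n\in K\}$ (with independent choices of the $x_i$), and $\mathbb{Q}(\alpha_1,\ldots,\alpha_n)$ is the subfield of $\mathbb{R}$ generated by $\alpha_1,\ldots,\alpha_n$; $X$ is regarded as an $\mathbb{F}$-vector space by restriction of scalars. *)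

theory Defs
  imports "HOL-Analysis.Analysis"
begin

section \<open>Real topological vector spaces\<close>

text \<open>Joint continuity of addition is part of \<^class>\<open>topological_ab_group_add\<close>. No separation
  axiom is required.\<close>

class topological_real_vector = topological_ab_group_add + real_vector +
  assumes tendsto_scaleR_Pair:
    "LIM p (nhds a \<times>\<^sub>F nhds x). fst p *\<^sub>R snd p :> nhds (a *\<^sub>R x)"

lemma topological_real_vector_iff_continuous_scaleR:
  "(\<forall>a (x :: 'a :: {topological_ab_group_add, real_vector}).
      LIM p (nhds a \<times>\<^sub>F nhds x). fst p *\<^sub>R snd p :> nhds (a *\<^sub>R x))
    \<longleftrightarrow> continuous_on UNIV (\<lambda>p :: real \<times> 'a. fst p *\<^sub>R snd p)"
  using tendsto_at_iff_tendsto_nhds[of "\<lambda>p :: real \<times> 'a. fst p *\<^sub>R snd p"]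
  by (auto simp: continuous_on_def nhds_prod[symmetric])

instance real_normed_vector \<subseteq> topological_real_vector
proof
  fix a :: real and x :: 'a
  show "LIM p (nhds a \<times>\<^sub>F nhds x). fst p *\<^sub>R snd p :> nhds (a *\<^sub>R x)"
    unfolding nhds_prod[symmetric]
    using tendsto_fst[OF filterlim_ident, of "(a, x)"] tendsto_snd[OF filterlim_ident, of "(a, x)"]
    by (intro tendsto_scaleR) auto
qed

section \<open>Generated subfields\<close>

text \<open>The case \<open>x = 0\<close> of the last clause only says \<open>0 \<in> F\<close>, because \<open>inverse 0 = 0\<close>.\<close>

definition is_subfield :: "'k::field set \<Rightarrow> bool"
  where "is_subfield F \<longleftrightarrow> 1 \<in> F \<and> (\<forall>x\<in>F. \<forall>y\<in>F. x - y \<in> F \<and> x * y \<in> F) \<and>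
    (\<forall>x\<in>F. inverse x \<in> F)"

definition rat_adjoin :: "real set \<Rightarrow> real set"
  where "rat_adjoin S = is_subfield hull S"

lemma is_subfield_Inter: "(\<And>F. F \<in> \<F> \<Longrightarrow> is_subfield F) \<Longrightarrow> is_subfield (\<Inter>\<F>)"
  unfolding is_subfield_def by blast

lemma is_subfield_rat_adjoin: "is_subfield (rat_adjoin S)"
  unfolding rat_adjoin_def by (rule hull_in) (auto intro: is_subfield_Inter)

lemma rat_adjoin_superset: "S \<subseteq> rat_adjoin S"
  unfolding rat_adjoin_def by (rule hull_subset)

lemma rat_adjoin_minimal: "is_subfield F \<Longrightarrow> S \<subseteq> F \<Longrightarrow> rat_adjoin S \<subseteq> F"
  unfolding rat_adjoin_def by (rule hull_minimal)

lemma is_subfield_Rats_subset: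
  fixes F :: "real set"
  assumes "is_subfield F"
  shows "\<rat> \<subseteq> F"
proof
  have one: "1 \<in> F" and diff: "\<And>x y. x \<in> F \<Longrightarrow> y \<in> F \<Longrightarrow> x - y \<in> F"
    and mult: "\<And>x y. x \<in> F \<Longrightarrow> y \<in> F \<Longrightarrow> x * y \<in> F"
    and inv: "\<And>x. x \<in> F \<Longrightarrow> inverse x \<in> F"
    using assms by (auto simp: is_subfield_def)
  have zero: "0 \<in> F" using diff[OF one one] by simp
  have uminus: "- x \<in> F" if "x \<in> F" for x using diff[OF zero that] by simp
  have add: "x + y \<in> F" if "x \<in> F" "y \<in> F" for x y
    using diff[OF that(1) uminus[OF that(2)]] by simp
  have nat: "of_nat k \<in> F" for k by (induction k) (auto intro: zero one add)
  have int: "of_int k \<in> F" for k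
    by (cases k rule: int_cases2) (auto intro: nat uminus)
  fix q :: real assume "q \<in> \<rat>"
  then obtain a b where "q = of_int a / of_int b" by (auto elim: Rats_cases')
  then show "q \<in> F" by (auto simp: divide_inverse intro: mult inv int)
qed

section \<open>Vector spaces and linear maps over a subfield\<close>

text \<open>The scalars form a subset of a type, so the axioms of \<^locale>\<open>vector_space\<close> and
  \<^locale>\<open>linear\<close> are required for scalars in \<open>F\<close> only; \<open>scale a\<close> for \<open>a \<notin> F\<close> is arbitrary.
  Restricting the scalars of a vector space to \<open>F\<close> keeps the function \<open>scale\<close>.\<close>

locale vector_space_over =
  fixes F :: "'k::field set"
    and scale :: "'k \<Rightarrow> 'v::ab_group_add \<Rightarrow> 'v"
  assumes subfield: "is_subfield F"
    and scale_right_distrib: "a \<in> F \<Longrightarrow> scale a (x + y) = scale a x + scale a y"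
    and scale_left_distrib: "a \<in> F \<Longrightarrow> b \<in> F \<Longrightarrow> scale (a + b) x = scale a x + scale b x"
    and scale_scale: "a \<in> F \<Longrightarrow> b \<in> F \<Longrightarrow> scale a (scale b x) = scale (a * b) x"
    and scale_one: "scale 1 x = x"

locale linear_over = vs1: vector_space_over F s1 + vs2: vector_space_over F s2
  for F :: "'k::field set"
    and s1 :: "'k \<Rightarrow> 'v::ab_group_add \<Rightarrow> 'v"
    and s2 :: "'k \<Rightarrow> 'w::ab_group_add \<Rightarrow> 'w" +
  fixes A :: "'v \<Rightarrow> 'w"
  assumes add: "A (x + y) = A x + A y"
    and scale: "a \<in> F \<Longrightarrow> A (s1 a x) = s2 a (A x)"

lemma vector_space_over_UNIV: "vector_space_over UNIV s \<longleftrightarrow> vector_space s"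
  by (auto simp: vector_space_over_def vector_space_def is_subfield_def)

lemma linear_over_UNIV: "linear_over UNIV s1 s2 A \<longleftrightarrow> Vector_Spaces.linear s1 s2 A"
  by (auto simp: linear_over_def linear_over_axioms_def vector_space_over_UNIV
      Vector_Spaces.linear_def module_hom_def module_hom_axioms_def module_iff_vector_space)

lemma vector_space_over_scaleR:
  "is_subfield F \<Longrightarrow> vector_space_over F (scaleR :: real \<Rightarrow> 'v::real_vector \<Rightarrow> 'v)"
  by (simp add: vector_space_over_def scaleR_add_right scaleR_add_left)

section \<open>Weighted sums of a set with itself\<close>

definition weighted_sumset :: "nat \<Rightarrow> (nat \<Rightarrow> real) \<Rightarrow> 'v::real_vector set \<Rightarrow> 'v set"
  where "weighted_sumset n \<alpha> K = {\<Sum>i=1..n. \<alpha> i *\<^sub>R x i | x. \<forall>i\<in>{1..n}. x i \<in> K}"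

end

theory Submission
  imports Defs
begin

text \<open>
  Exchanging a shift of the first argument for a shift of the second shows that
  \<open>f (x + u) - f x\<close> does not depend on \<open>x\<close> when \<open>u\<close> is small. It is therefore a locally additive
  function of \<open>u\<close>, which extends to an additive map \<open>A\<close> on the whole space because neighbourhoods
  of \<open>0\<close> are absorbing. Now \<open>f - A\<close> is locally constant, hence constant on the connected set \<open>K\<close>,
  and the scalars commuting with \<open>A\<close> form a subfield containing every \<open>\<alpha> i\<close>.
\<close>

section \<open>Neighbourhoods of zero\<close>

lemma filterlim_add_nhds_0:
  fixes x :: "'x::topological_real_vector"
  shows "filterlim (\<lambda>u. x + u) (nhds x) (nhds 0)"
  using tendsto_add[OF tendsto_const[of x] filterlim_ident[of "nhds (0::'x)"]] by simp

lemma filterlim_diff_nhds_self: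
  fixes x :: "'x::topological_real_vector"
  shows "filterlim (\<lambda>z. z - x) (nhds 0) (nhds x)"
  using tendsto_diff[OF filterlim_ident[of "nhds x"] tendsto_const[of x]] by simp

lemma tendsto_scaleR_tvs:
  fixes g :: "'b \<Rightarrow> 'x::topological_real_vector"
  assumes "(c \<longlongrightarrow> a) G" "(g \<longlongrightarrow> x) G"
  shows "((\<lambda>z. c z *\<^sub>R g z) \<longlongrightarrow> a *\<^sub>R x) G"
  using filterlim_compose[OF tendsto_scaleR_Pair filterlim_Pair[OF assms]] by simp

text \<open>Continuity of scalar multiplication at \<open>(0, 0)\<close> gives \<open>P\<close> for
  all products \<open>s v\<close> with \<open>\<bar>s\<bar> < d\<close> and \<open>v\<close> near 0.
  Writing \<open>t w\<close> as \<open>(t d / 2)\<close> times \<open>(2 / d) w\<close> stretches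
  this range of scalars to \<open>\<bar>t\<bar> \<le> 1\<close>; halving \<open>d\<close> keeps the
  bound strict.\<close>

lemma eventually_balanced_nhds_0:
  fixes P :: "'x::topological_real_vector \<Rightarrow> bool"
  assumes "eventually P (nhds 0)"
  shows "eventually (\<lambda>w. \<forall>t. \<bar>t\<bar> \<le> 1 \<longrightarrow> P (t *\<^sub>R w)) (nhds 0)"
proof -
  have "eventually (\<lambda>p. P (fst p *\<^sub>R snd p)) (nhds (0::real) \<times>\<^sub>F nhds (0::'x))"
    using tendsto_scaleR_Pair[of 0 "0::'x"] assms by (auto simp: filterlim_iff)
  then obtain Pt Pv where Pt: "eventually Pt (nhds (0::real))"
    and Pv: "eventually Pv (nhds (0::'x))"
    and P: "\<And>t v. Pt t \<Longrightarrow> Pv v \<Longrightarrow> P (t *\<^sub>R v)"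
    unfolding eventually_prod_filter by auto
  from Pt obtain d where d: "d > 0" "\<And>t. \<bar>t\<bar> < d \<Longrightarrow> Pt t"
    by (auto simp: eventually_nhds_metric dist_real_def)
  have "((\<lambda>w::'x. (2 / d) *\<^sub>R w) \<longlongrightarrow> (2 / d) *\<^sub>R 0) (nhds 0)"
    by (intro tendsto_scaleR_tvs tendsto_const filterlim_ident)
  then have "eventually (\<lambda>w. Pv ((2 / d) *\<^sub>R w)) (nhds 0)"
    using Pv by (simp add: filterlim_iff)
  then show ?thesis
  proof (rule eventually_mono, intro allI impI)
    fix w :: 'x and t :: real assume "Pv ((2 / d) *\<^sub>R w)" "\<bar>t\<bar> \<le> 1"
    moreover have "Pt (t * d / 2)" using d(1) \<open>\<bar>t\<bar> \<le> 1\<close>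
      by (intro d(2)) (use mult_right_mono[of "\<bar>t\<bar>" 1 d] in \<open>simp add: abs_mult\<close>)
    ultimately have "P ((t * d / 2) *\<^sub>R (2 / d) *\<^sub>R w)" by (intro P)
    then show "P (t *\<^sub>R w)" using d(1) by simp
  qed
qed

text \<open>The factors \<open>1 / m\<close> tend to 0. Integer denominators are what is wanted
  here: a map known only to be additive commutes with integer multiples, so shrinking by
  \<open>1 / m\<close> can be undone.\<close>

lemma eventually_absorbing_nhds_0:
  fixes P :: "'x::topological_real_vector \<Rightarrow> bool"
  assumes "eventually P (nhds 0)"
  shows "eventually (\<lambda>m::nat. P ((1 / real m) *\<^sub>R x)) sequentially"
proof -
  have "((\<lambda>m::nat. (1 / real m) *\<^sub>R x) \<longlongrightarrow> 0 *\<^sub>R x) sequentially"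
    by (intro tendsto_scaleR_tvs tendsto_const lim_1_over_n)
  then show ?thesis using assms by (simp add: filterlim_iff)
qed

section \<open>Extending locally additive maps\<close>

context vector_space_over
begin

lemma one_mem: "1 \<in> F"
  and diff_mem: "a \<in> F \<Longrightarrow> b \<in> F \<Longrightarrow> a - b \<in> F"
  and mult_mem: "a \<in> F \<Longrightarrow> b \<in> F \<Longrightarrow> a * b \<in> F"
  and inverse_mem: "a \<in> F \<Longrightarrow> inverse a \<in> F"
  using subfield by (auto simp: is_subfield_def)

lemma zero_mem: "0 \<in> F"
  using diff_mem[OF one_mem one_mem] by simp

lemma add_mem: "a \<in> F \<Longrightarrow> b \<in> F \<Longrightarrow> a + b \<in> F"
  using diff_mem[of a "0 - b"] diff_mem[of 0 b] zero_mem by simp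

lemma of_nat_mem: "of_nat m \<in> F"
  by (induction m) (auto intro: zero_mem one_mem add_mem)

lemma sum_mem: "(\<And>i. i \<in> I \<Longrightarrow> c i \<in> F) \<Longrightarrow> sum c I \<in> F"
  by (induction I rule: infinite_finite_induct) (auto intro: zero_mem add_mem)

lemma scale_zero_right: "a \<in> F \<Longrightarrow> scale a 0 = 0"
  using scale_right_distrib[of a 0 0] by simp

lemma scale_zero_left: "scale 0 x = 0"
  using scale_left_distrib[of 0 0 x] zero_mem by simp

lemma scale_right_diff: "a \<in> F \<Longrightarrow> scale a (x - y) = scale a x - scale a y"
  using scale_right_distrib[of a "x - y" y] by (simp add: algebra_simps)

lemma scale_left_diff: "a \<in> F \<Longrightarrow> b \<in> F \<Longrightarrow> scale (a - b) x = scale a x - scale b x"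
  using scale_left_distrib[of "a - b" b x] diff_mem by (simp add: algebra_simps)

lemma scale_sum_left: "(\<And>i. i \<in> I \<Longrightarrow> c i \<in> F) \<Longrightarrow> scale (sum c I) x = (\<Sum>i\<in>I. scale (c i) x)"
  by (induction I rule: infinite_finite_induct)
    (auto simp: scale_zero_left scale_left_distrib sum_mem)

lemma scale_inverse: "a \<in> F \<Longrightarrow> a \<noteq> 0 \<Longrightarrow> scale (inverse a) (scale a x) = x"
  using scale_scale[of "inverse a" a x] by (simp add: inverse_mem scale_one)

lemma scale_eq_iff: "a \<in> F \<Longrightarrow> a \<noteq> 0 \<Longrightarrow> scale a x = scale a y \<longleftrightarrow> x = y"
  by (metis scale_inverse)

lemma additive_of_nat:
  fixes A :: "'x::real_vector \<Rightarrow> 'v"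
  assumes "\<And>x y. A (x + y) = A x + A y"
  shows "A (real m *\<^sub>R x) = scale (of_nat m) (A x)"
proof (induction m)
  case 0
  have "A 0 = 0" using assms[of 0 0] by simp
  then show ?case by (simp add: scale_zero_left)
next
  case (Suc m)
  then show ?case
    using assms[of x "real m *\<^sub>R x"]
    by (simp add: scaleR_add_left scale_left_distrib scale_one one_mem of_nat_mem)
qed

text \<open>The extension is \<open>A x = m D(x / m)\<close> for any \<open>m > 0\<close> with
  \<open>x / m\<close> in \<open>W\<close>. Passing to a common denominator shows that the choice of
  \<open>m\<close> is irrelevant, and additivity follows by choosing one \<open>m\<close> that
  serves \<open>x\<close>, \<open>y\<close> and \<open>x + y\<close>. The sum \<open>u + v\<close>
  in \<open>D_add\<close> may leave \<open>W\<close>.\<close>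

lemma locally_additive_extension:
  fixes D :: "'x::topological_real_vector \<Rightarrow> 'v"
  assumes W: "eventually (\<lambda>u. u \<in> W) (nhds 0)"
    and balanced: "\<And>u t. u \<in> W \<Longrightarrow> \<bar>t\<bar> \<le> 1 \<Longrightarrow> t *\<^sub>R u \<in> W"
    and D_add: "\<And>u v. u \<in> W \<Longrightarrow> v \<in> W \<Longrightarrow> D (u + v) = D u + D v"
  obtains A where "\<And>x y. A (x + y) = A x + A y" "\<And>u. u \<in> W \<Longrightarrow> A u = D u"
proof -
  have zero: "0 \<in> W" using eventually_nhds_x_imp_x[OF W] .
  have D0: "D 0 = 0" using D_add[OF zero zero] by simp
  have multiple: "D (real k *\<^sub>R u) = scale (of_nat k) (D u)" if "real m *\<^sub>R u \<in> W" "k \<le> m" for k m u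
    using that(2)
  proof (induction k)
    case 0
    then show ?case by (simp add: D0 scale_zero_left)
  next
    case (Suc k)
    \<comment> \<open>Since \<open>D\<close> is additive only on arguments in \<open>W\<close>,
      every intermediate multiple must stay there: \<open>j u\<close> is \<open>j / m\<close> times
      \<open>m u\<close>, and \<open>W\<close> is balanced.\<close>
    have mem: "real j *\<^sub>R u \<in> W" if "j \<le> m" for j
      using balanced[OF \<open>real m *\<^sub>R u \<in> W\<close>, of "real j / real m"] that zero
      by (cases "m = 0") auto
    have "D (u + real k *\<^sub>R u) = D u + D (real k *\<^sub>R u)"
      using mem[of 1] mem[of k] Suc.prems by (intro D_add) auto
    then show ?case
      using Suc by (simp add: scaleR_add_left scale_left_distrib scale_one one_mem of_nat_mem)
  qed
  \<comment> \<open>The condition \<open>m > 0\<close> excludes the junk value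
    \<open>1 / 0 = 0\<close>, which would admit \<open>m = 0\<close> for every \<open>x\<close> and
    give \<open>E 0 x = 0\<close>.\<close>
  define Q where "Q x m \<longleftrightarrow> m > 0 \<and> (1 / real m) *\<^sub>R x \<in> W" for x and m :: nat
  have ev_Q: "eventually (Q x) sequentially" for x
    unfolding Q_def
    using eventually_absorbing_nhds_0[OF W] eventually_gt_at_top by (rule eventually_conj[rotated])
  define E where "E m x = scale (of_nat m) (D ((1 / real m) *\<^sub>R x))" for m :: nat and x
  \<comment> \<open>\<open>multiple\<close> is applied to \<open>x / (m k)\<close>, whose
    \<open>k\<close>-fold multiple \<open>x / m\<close> lies in \<open>W\<close>. Two admissible
    \<open>m\<close> and \<open>k\<close> are then compared through \<open>m k\<close>.\<close>
  have refine: "E (m * k) x = E m x" if "Q x m" "k > 0" for m k x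
  proof -
    have "D ((1 / real m) *\<^sub>R x) = scale (of_nat k) (D ((1 / real (m * k)) *\<^sub>R x))"
      using multiple[of k "(1 / real (m * k)) *\<^sub>R x" k] that by (simp add: Q_def)
    then show ?thesis by (simp add: E_def scale_scale of_nat_mem)
  qed
  have indep: "E m x = E k x" if "Q x m" "Q x k" for m k x
    using refine[of x m k] refine[of x k m] that by (simp add: Q_def mult.commute)
  define A where "A x = E (SOME m. Q x m) x" for x
  have A: "A x = E m x" if "Q x m" for x m
    unfolding A_def using someI[of "Q x" m] that by (intro indep) auto
  show thesis
  proof (rule that)
    fix x y
    have "eventually (\<lambda>m. Q x m \<and> Q y m \<and> Q (x + y) m) sequentially"
      by (intro eventually_conj ev_Q)
    then obtain m where m: "Q x m" "Q y m" "Q (x + y) m"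
      by (auto simp: eventually_sequentially)
    then have "D ((1 / real m) *\<^sub>R (x + y)) = D ((1 / real m) *\<^sub>R x) + D ((1 / real m) *\<^sub>R y)"
      by (simp only: scaleR_add_right D_add Q_def)
    then show "A (x + y) = A x + A y"
      using A[OF m(1)] A[OF m(2)] A[OF m(3)] by (simp add: E_def scale_right_distrib of_nat_mem)
  next
    fix u assume "u \<in> W"
    then show "A u = D u" using A[of u 1] by (simp add: Q_def E_def scale_one)
  qed
qed

end

text \<open>Additivity makes the set \<open>?C\<close> of scalars commuting with \<open>A\<close>
  closed under differences; products and inverses come from iterating and cancelling. As
  \<open>?C\<close> contains \<open>S\<close>, minimality of the generated subfield applies.\<close>

lemma linear_over_rat_adjoin:
  fixes A :: "'x::real_vector \<Rightarrow> 'y::ab_group_add"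
    and scale :: "real \<Rightarrow> 'y \<Rightarrow> 'y"
  assumes "vector_space_over (rat_adjoin S) scale"
    and add: "\<And>x y. A (x + y) = A x + A y"
    and scale: "\<And>a x. a \<in> S \<Longrightarrow> A (a *\<^sub>R x) = scale a (A x)"
  shows "linear_over (rat_adjoin S) scaleR scale A"
proof -
  interpret Y: vector_space_over "rat_adjoin S" scale by fact
  have diff: "A (x - y) = A x - A y" for x y
    using add[of "x - y" y] by (simp add: algebra_simps)
  let ?C = "{a \<in> rat_adjoin S. \<forall>x. A (a *\<^sub>R x) = scale a (A x)}"
  have "is_subfield ?C"
    unfolding is_subfield_def
  proof (intro conjI ballI)
    fix a assume a: "a \<in> ?C"
    \<comment> \<open>Homogeneity for \<open>a\<close> is used at \<open>inverse a\<close> times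
      \<open>x\<close>, and \<open>a\<close> is then cancelled. For \<open>a = 0\<close> the claim
      is the hypothesis itself, because \<open>inverse 0 = 0\<close>.\<close>
    have "A (inverse a *\<^sub>R x) = scale (inverse a) (A x)" for x
    proof (cases "a = 0")
      case False
      have "A x = scale a (A (inverse a *\<^sub>R x))"
        using a False by (auto simp: scaleR_scaleR dest!: spec[of _ "inverse a *\<^sub>R x"])
      then show ?thesis using a False by (simp add: Y.scale_inverse)
    qed (use a in simp)
    then show "inverse a \<in> ?C" using a by (simp add: Y.inverse_mem)
  next
    fix a b assume a: "a \<in> ?C" and b: "b \<in> ?C"
    then show "a - b \<in> ?C"
      by (simp add: Y.diff_mem scaleR_diff_left diff Y.scale_left_diff)
    have "A ((a * b) *\<^sub>R x) = scale (a * b) (A x)" for x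
      using a b by (simp add: Y.scale_scale flip: scaleR_scaleR)
    then show "a * b \<in> ?C" using a b by (simp add: Y.mult_mem)
  qed (simp add: Y.one_mem Y.scale_one)
  then have "rat_adjoin S \<subseteq> ?C"
    using scale rat_adjoin_superset by (intro rat_adjoin_minimal) auto
  then show ?thesis
    using add by (auto simp: linear_over_def linear_over_axioms_def assms(1)
        vector_space_over_scaleR is_subfield_rat_adjoin)
qed

section \<open>The functional equation\<close>

theorem corollary1p3:
  fixes n :: nat
    and \<alpha> :: "nat \<Rightarrow> real"
    and F :: "real set"
    and K :: "'x::topological_real_vector set"
    and scale :: "real \<Rightarrow> 'y::ab_group_add \<Rightarrow> 'y"
    and f :: "'x \<Rightarrow> 'y"
  assumes "n \<ge> 2"
    and "\<forall>i\<in>{1..n}. \<alpha> i \<noteq> 0"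
    and "F = rat_adjoin (\<alpha> ` {1..n})"
    and "vector_space_over F scale"
    and "K \<noteq> {}" and "open K" and "connected K"
    and "weighted_sumset n \<alpha> K \<subseteq> K"
  shows "(\<forall>x. (\<forall>i\<in>{1..n}. x i \<in> K) \<longrightarrow>
            f (\<Sum>i=1..n. \<alpha> i *\<^sub>R x i) = (\<Sum>i=1..n. scale (\<alpha> i) (f (x i))))
    \<longleftrightarrow> (\<exists>A b. linear_over F (scaleR :: real \<Rightarrow> 'x \<Rightarrow> 'x) scale A \<and>
            (\<forall>x\<in>K. f x = A x + b) \<and>
            ((\<Sum>i=1..n. \<alpha> i) \<noteq> 1 \<longrightarrow> b = 0))"
proof -
  interpret Y: vector_space_over F scale by fact
  have \<alpha>_mem: "\<alpha> i \<in> F" if "i \<in> {1..n}" for i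
    using that rat_adjoin_superset[of "\<alpha> ` {1..n}"] assms(3) by blast
  have sum_in_K: "(\<Sum>i=1..n. \<alpha> i *\<^sub>R x i) \<in> K" if "\<forall>i\<in>{1..n}. x i \<in> K" for x
    using assms(8) that by (auto simp: weighted_sumset_def)
  \<comment> \<open>The coefficient sum is kept in front of \<open>b\<close>, so this identity
    serves both directions: it verifies the equation for affine maps and later forces
    \<open>b = 0\<close>.\<close>
  have affine: "A (\<Sum>i=1..n. \<alpha> i *\<^sub>R x i) + scale (\<Sum>i=1..n. \<alpha> i) b =
      (\<Sum>i=1..n. scale (\<alpha> i) (f (x i)))"
    if lin: "linear_over F scaleR scale A" and f: "\<forall>x\<in>K. f x = A x + b"
      and x: "\<forall>i\<in>{1..n}. x i \<in> K" for A b x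
  proof -
    interpret A: linear_over F scaleR scale A by fact
    have A0: "A 0 = 0" using A.add[of 0 0] by simp
    have "A (\<Sum>i\<in>I. \<alpha> i *\<^sub>R x i) = (\<Sum>i\<in>I. A (\<alpha> i *\<^sub>R x i))" for I
      by (induction I rule: infinite_finite_induct) (auto simp: A0 A.add)
    then have "A (\<Sum>i=1..n. \<alpha> i *\<^sub>R x i) = (\<Sum>i=1..n. scale (\<alpha> i) (A (x i)))"
      by (simp add: A.scale \<alpha>_mem)
    then have "A (\<Sum>i=1..n. \<alpha> i *\<^sub>R x i) + scale (\<Sum>i=1..n. \<alpha> i) b =
        (\<Sum>i=1..n. scale (\<alpha> i) (A (x i)) + scale (\<alpha> i) b)"
      using Y.scale_sum_left[of "{1..n}" \<alpha> b] \<alpha>_mem by (simp add: sum.distrib)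
    also have "\<dots> = (\<Sum>i=1..n. scale (\<alpha> i) (f (x i)))"
      using f x by (intro sum.cong) (auto simp: Y.scale_right_distrib \<alpha>_mem)
    finally show ?thesis .
  qed
  show ?thesis
  proof

    \<comment> \<open>Affine maps solve the equation\<close>
    assume "\<exists>A b. linear_over F (scaleR :: real \<Rightarrow> 'x \<Rightarrow> 'x) scale A \<and>
            (\<forall>x\<in>K. f x = A x + b) \<and> ((\<Sum>i=1..n. \<alpha> i) \<noteq> 1 \<longrightarrow> b = 0)"
    then obtain A b where A: "linear_over F scaleR scale A" "\<forall>x\<in>K. f x = A x + b"
      and b: "(\<Sum>i=1..n. \<alpha> i) \<noteq> 1 \<longrightarrow> b = 0" by blast
    have "scale (\<Sum>i=1..n. \<alpha> i) b = b"
      using b by (cases "(\<Sum>i=1..n. \<alpha> i) = 1")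
        (auto simp: Y.scale_one intro!: Y.scale_zero_right Y.sum_mem \<alpha>_mem)
    then show "\<forall>x. (\<forall>i\<in>{1..n}. x i \<in> K) \<longrightarrow>
        f (\<Sum>i=1..n. \<alpha> i *\<^sub>R x i) = (\<Sum>i=1..n. scale (\<alpha> i) (f (x i)))"
      using affine[OF A] A(2) sum_in_K by (metis (no_types, lifting))
  next
    assume eq: "\<forall>x. (\<forall>i\<in>{1..n}. x i \<in> K) \<longrightarrow>
        f (\<Sum>i=1..n. \<alpha> i *\<^sub>R x i) = (\<Sum>i=1..n. scale (\<alpha> i) (f (x i)))"

    \<comment> \<open>Increments independent of the base point\<close>
    obtain y where y: "y \<in> K" using assms(5) by blast
    have K_nhds: "eventually (\<lambda>u. x + u \<in> K) (nhds 0)" if "x \<in> K" for x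
      using eventually_compose_filterlim[OF eventually_nhds_in_open[OF assms(6) that]
          filterlim_add_nhds_0] .
    \<comment> \<open>Moving the first argument by \<open>u\<close> changes the weighted sum exactly
      as moving the second by \<open>\<beta>\<close> times \<open>u\<close> does.\<close>
    define \<beta> where "\<beta> = \<alpha> 1 / \<alpha> 2"
    have \<alpha>12: "\<alpha> 1 \<noteq> 0" "\<alpha> 2 \<noteq> 0" "\<alpha> 1 \<in> F" "\<alpha> 2 \<in> F"
      using assms(1,2) \<alpha>_mem by auto
    \<comment> \<open>The tuples \<open>(x + u, y, y, ...)\<close> and
      \<open>(x, y + \<beta> u, y, ...)\<close> have equal weighted sums, so the equation equates
      their right-hand sides and the common terms cancel. The right-hand side obtained does not
      involve \<open>x\<close>.\<close>
    have exchange: "scale (\<alpha> 1) (f (x + u) - f x) = scale (\<alpha> 2) (f (y + \<beta> *\<^sub>R u) - f y)"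
      if "x \<in> K" "x + u \<in> K" "y + \<beta> *\<^sub>R u \<in> K" for x u
    proof -
      have idx: "{1..n} = insert 1 (insert 2 {3..n})" using assms(1) by auto
      define z where "z p q i = (if i = 1 then p else if i = 2 then q else y)" for p q and i :: nat
      \<comment> \<open>The target type \<open>'b\<close> stays general so that the same splitting
        applies to the sum in the domain and to the sum of values.\<close>
      have split: "(\<Sum>i=1..n. g i (z p q i)) = g 1 p + (g 2 q + (\<Sum>i=3..n. g i y))"
        for p q and g :: "nat \<Rightarrow> 'x \<Rightarrow> 'b::ab_group_add"
        unfolding idx by (auto simp: z_def)
      have "f (\<alpha> 1 *\<^sub>R p + (\<alpha> 2 *\<^sub>R q + (\<Sum>i=3..n. \<alpha> i *\<^sub>R y))) =
          scale (\<alpha> 1) (f p) + (scale (\<alpha> 2) (f q) + (\<Sum>i=3..n. scale (\<alpha> i) (f y)))"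
        if "p \<in> K" "q \<in> K" for p q
      proof -
        have "\<forall>i\<in>{1..n}. z p q i \<in> K" using that y by (simp add: z_def)
        with eq have "f (\<Sum>i=1..n. \<alpha> i *\<^sub>R z p q i) = (\<Sum>i=1..n. scale (\<alpha> i) (f (z p q i)))"
          by blast
        then show ?thesis
          unfolding split[of "\<lambda>i v. \<alpha> i *\<^sub>R v"] split[of "\<lambda>i v. scale (\<alpha> i) (f v)"] .
      qed
      from this[of "x + u" y] this[of x "y + \<beta> *\<^sub>R u"] that y
      show ?thesis using \<alpha>12
        by (simp add: \<beta>_def algebra_simps Y.scale_right_diff)
    qed
    \<comment> \<open>Sums \<open>u + v\<close> need not lie in \<open>W\<close>, so continuity of
      addition at \<open>(0, 0)\<close> is used to keep \<open>y + (u + v)\<close> in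
      \<open>K\<close>.\<close>
    obtain P1 P2 where P: "eventually P1 (nhds 0)" "eventually P2 (nhds 0)"
      and P_add: "\<And>u v. P1 u \<Longrightarrow> P2 v \<Longrightarrow> y + (u + v) \<in> K"
    proof -
      have "eventually (\<lambda>p. y + (fst p + snd p) \<in> K) (nhds (0::'x) \<times>\<^sub>F nhds (0::'x))"
        using eventually_compose_filterlim[OF K_nhds[OF y], of "\<lambda>p. fst p + snd p"]
          tendsto_add_Pair[of "0::'x" 0] by simp
      then show thesis
        by (auto simp: eventually_prod_filter intro: that)
    qed
    have P\<beta>: "eventually (\<lambda>u. y + \<beta> *\<^sub>R u \<in> K) (nhds 0)"
    proof -
      have "((\<lambda>u::'x. \<beta> *\<^sub>R u) \<longlongrightarrow> \<beta> *\<^sub>R 0) (nhds 0)"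
        by (intro tendsto_scaleR_tvs tendsto_const filterlim_ident)
      then show ?thesis using eventually_compose_filterlim[OF K_nhds[OF y]] by simp
    qed
    \<comment> \<open>Quantifying over all \<open>t\<close> makes \<open>W\<close> balanced, as the
      extension lemma demands. The last conjunct is the side condition of
      \<open>exchange\<close>.\<close>
    define W where "W = {u. \<forall>t. \<bar>t\<bar> \<le> 1 \<longrightarrow> P1 (t *\<^sub>R u) \<and> P2 (t *\<^sub>R u) \<and>
      y + t *\<^sub>R u \<in> K \<and> y + \<beta> *\<^sub>R t *\<^sub>R u \<in> K}"
    have W_ev: "eventually (\<lambda>u. u \<in> W) (nhds 0)"
      unfolding W_def mem_Collect_eq
      by (intro eventually_balanced_nhds_0 eventually_conj P P\<beta> K_nhds y)
    have W_balanced: "t *\<^sub>R u \<in> W" if "u \<in> W" "\<bar>t\<bar> \<le> 1" for t u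
    proof -
      have "\<bar>s * t\<bar> \<le> 1" if "\<bar>s\<bar> \<le> 1" for s
        using that \<open>\<bar>t\<bar> \<le> 1\<close> by (simp add: abs_mult mult_le_one)
      then show ?thesis using \<open>u \<in> W\<close> by (simp add: W_def mult.assoc)
    qed
    have W: "P1 u" "P2 u" "y + u \<in> K" "y + \<beta> *\<^sub>R u \<in> K" if "u \<in> W" for u
      using that by (auto simp: W_def dest!: spec[of _ 1])
    define D where "D u = f (y + u) - f y" for u
    \<comment> \<open>\<open>exchange\<close> at \<open>x\<close> and at \<open>y\<close> has the
      same right-hand side, and the nonzero scalar \<open>\<alpha> 1\<close> cancels.\<close>
    have D: "f (x + u) - f x = D u" if "x \<in> K" "x + u \<in> K" "u \<in> W" for x u
      using exchange[of x u] exchange[of y u] that W[OF that(3)] y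
        Y.scale_eq_iff[OF \<alpha>12(3,1), of "f (x + u) - f x" "D u"]
      by (simp add: D_def)
    \<comment> \<open>The increment from \<open>y\<close> to \<open>y + u + v\<close> is taken in
      two stages; the second starts at \<open>y + u\<close>, where base point independence gives
      \<open>D v\<close>.\<close>
    have D_add: "D (u + v) = D u + D v" if "u \<in> W" "v \<in> W" for u v
      using D[of "y + u" v] that P_add[of u v] W[OF that(1)] W[OF that(2)]
      by (simp add: D_def algebra_simps)

    \<comment> \<open>The additive map and the constant on \<open>K\<close>\<close>
    obtain A where A_add: "\<And>x y. A (x + y) = A x + A y" and A_D: "\<And>u. u \<in> W \<Longrightarrow> A u = D u"
      using Y.locally_additive_extension[OF W_ev W_balanced D_add] by blast
    have shift: "f (x + u) = f x + A u" if "x \<in> K" "x + u \<in> K" "u \<in> W" for x u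
      using D[OF that] A_D[OF that(3)] by (simp add: algebra_simps)
    define b where "b = f y - A y"
    have f_eq: "f x = A x + b" if "x \<in> K" for x
    proof -
      have "f x - A x = f y - A y"
      \<comment> \<open>For \<open>z\<close> in \<open>K\<close> close to \<open>a\<close>, the
        difference \<open>z - a\<close> lies in \<open>W\<close>, so \<open>f\<close> and
        \<open>A\<close> have the same increment from \<open>a\<close> to \<open>z\<close>.\<close>
      proof (rule connected_local_const[OF assms(7) that y, of "\<lambda>x. f x - A x"], intro ballI)
        fix a assume "a \<in> K"
        have "eventually (\<lambda>z. z - a \<in> W) (nhds a)"
          using eventually_compose_filterlim[OF W_ev filterlim_diff_nhds_self] .
        then have "eventually (\<lambda>z. z \<in> K \<longrightarrow> f a - A a = f z - A z) (nhds a)"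
        proof (rule eventually_mono, intro impI)
          fix z assume "z - a \<in> W" "z \<in> K"
          then show "f a - A a = f z - A z"
            using shift[of a "z - a"] A_add[of a "z - a"] \<open>a \<in> K\<close> by (simp add: algebra_simps)
        qed
        then show "eventually (\<lambda>z. f a - A a = f z - A z) (at a within K)"
          by (simp add: eventually_at_filter eventually_mono)
      qed
      then show ?thesis by (simp add: b_def algebra_simps)
    qed

    \<comment> \<open>Homogeneity for the coefficients and the value of \<open>b\<close>\<close>
    define s where "s = (\<Sum>i=1..n. \<alpha> i *\<^sub>R y)"
    have s: "s \<in> K" unfolding s_def using sum_in_K[of "\<lambda>_. y"] y by simp
    have f_s: "f s = (\<Sum>i=1..n. scale (\<alpha> i) (f y))"
      unfolding s_def using eq[rule_format, of "\<lambda>_. y"] y by simp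
    \<comment> \<open>One coordinate of the constant tuple \<open>y\<close> is moved by a small
      \<open>u = x / m\<close>. Computing \<open>f\<close> at the new weighted sum by the equation
      and by \<open>f_eq\<close> gives homogeneity at \<open>u\<close>; multiplying by
      \<open>m\<close> carries it to \<open>x\<close>.\<close>
    have homogeneous: "A (\<alpha> i *\<^sub>R x) = scale (\<alpha> i) (A x)" if i: "i \<in> {1..n}" for i x
    proof -
      have "eventually (\<lambda>m::nat. y + (1 / real m) *\<^sub>R x \<in> K) sequentially"
        by (intro eventually_absorbing_nhds_0 K_nhds y)
      then obtain m :: nat where m: "m > 0" "y + (1 / real m) *\<^sub>R x \<in> K"
        using eventually_happens'[OF _ eventually_conj[OF _ eventually_gt_at_top[of 0]]]
        by (metis sequentially_bot)
      define u where "u = (1 / real m) *\<^sub>R x"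
      define z where "z j = (if j = i then y + u else y)" for j
      have z: "\<forall>j\<in>{1..n}. z j \<in> K" using m y by (auto simp: z_def u_def)
      have sum_z: "(\<Sum>j=1..n. \<alpha> j *\<^sub>R z j) = s + \<alpha> i *\<^sub>R u"
      proof -
        have "(\<Sum>j=1..n. \<alpha> j *\<^sub>R z j) = s + (\<Sum>j=1..n. if j = i then \<alpha> j *\<^sub>R u else 0)"
          unfolding s_def z_def sum.distrib[symmetric]
          by (intro sum.cong) (auto simp: scaleR_add_right)
        then show ?thesis using i by simp
      qed
      have "(\<Sum>j=1..n. scale (\<alpha> j) (f (z j))) =
          f s + (\<Sum>j=1..n. if j = i then scale (\<alpha> j) (A u) else 0)"
        unfolding f_s sum.distrib[symmetric]
        using f_eq m y A_add \<alpha>_mem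
        by (intro sum.cong) (auto simp: z_def u_def ac_simps simp flip: Y.scale_right_distrib)
      then have "f (s + \<alpha> i *\<^sub>R u) = f s + scale (\<alpha> i) (A u)"
        using eq[rule_format, of z] z i unfolding sum_z by simp
      moreover have "f (s + \<alpha> i *\<^sub>R u) = f s + A (\<alpha> i *\<^sub>R u)"
        using f_eq[OF s] f_eq[of "s + \<alpha> i *\<^sub>R u"] sum_in_K[OF z] sum_z A_add
        by (simp add: ac_simps)
      ultimately have u: "A (\<alpha> i *\<^sub>R u) = scale (\<alpha> i) (A u)" by simp
      have "A (\<alpha> i *\<^sub>R x) = scale (of_nat m) (A (\<alpha> i *\<^sub>R u))" "A x = scale (of_nat m) (A u)"
        using Y.additive_of_nat[OF A_add, of m "\<alpha> i *\<^sub>R u"] Y.additive_of_nat[OF A_add, of m u] m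
        by (simp_all add: u_def)
      then show ?thesis
        using u \<alpha>_mem[OF i] by (simp add: Y.of_nat_mem Y.scale_scale mult.commute)
    qed
    have lin: "linear_over F scaleR scale A"
      unfolding assms(3)
      by (rule linear_over_rat_adjoin) (use assms(3,4) A_add homogeneous in auto)
    have "b = 0" if "(\<Sum>i=1..n. \<alpha> i) \<noteq> 1"
    proof -
      \<comment> \<open>Both sides equal \<open>f s\<close>: the left by \<open>affine\<close> at
        the constant tuple \<open>y\<close>, the right by \<open>f_eq\<close>. Hence the coefficient
        sum minus 1, a nonzero element of \<open>F\<close>, annihilates \<open>b\<close>.\<close>
      have "A s + scale (\<Sum>i=1..n. \<alpha> i) b = A s + b"
        using affine[OF lin _, of b "\<lambda>_. y"] f_eq y f_s f_eq[OF s] by (simp add: s_def)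
      moreover have mem: "(\<Sum>i=1..n. \<alpha> i) \<in> F" by (intro Y.sum_mem \<alpha>_mem)
      ultimately have "scale ((\<Sum>i=1..n. \<alpha> i) - 1) b = 0"
        by (simp add: Y.scale_left_diff Y.one_mem Y.scale_one)
      then show "b = 0"
        using that Y.scale_eq_iff[OF Y.diff_mem[OF mem Y.one_mem], of b 0]
        using Y.scale_zero_right[OF Y.diff_mem[OF mem Y.one_mem]] by simp
    qed
    then show "\<exists>A b. linear_over F (scaleR :: real \<Rightarrow> 'x \<Rightarrow> 'x) scale A \<and>
            (\<forall>x\<in>K. f x = A x + b) \<and> ((\<Sum>i=1..n. \<alpha> i) \<noteq> 1 \<longrightarrow> b = 0)"
      using lin f_eq by blast
  qed
qed

end
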